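(* Let $\Phi=(G,\varphi)$ be a $\mathbb{T}$-gain graph on a connected simple graph $G$ with vertex set $\{v_1,\dots,v_n\}$. The following are equivalent: (1) $\Phi$ is balanced; (2) $\Phi$ is ordering independent and $\mathrm{nullity}(\mathcal{DL}^{\max}(\Phi))=1$; (3) $\Phi$ is ordering independent and $\mathrm{nullity}(\mathcal{DL}^{\min}(\Phi))=1$; (4) $\Phi$ is distance compatible and $\mathrm{nullity}(\mathcal{DL}(\Phi))=1$; (5) $\Phi$ is ordering independent and $\det\mathcal{DL}^{\max}(\Phi)=0$; (6) $\Phi$ is ordering independent and $\det\mathcal{DL}^{\min}(\Phi)=0$; (7) $\Phi$ is distance compatible and $\det\mathcal{DL}(\Phi)=0$.
   Context: $\mathbb{T}=\{z\in\mathbb{C}:|z|=1\}$. A $\mathbb{T}$-gain graph $\Phi=(G,\varphi)$ assigns to each of the two orientations $\vec e_{i,j},\vec e_{j,i}$ of every edge $v_iv_j$ of $G$ a gain in $\mathbb{T}$ with $\varphi(\vec e_{j,i})=\overline{\varphi(\vec e_{i,j})}$. The gain of an oriented path or cycle is the product of the gains of its consecutive oriented edges; $\Phi$ is balanced if every cycle has gain $1$. $d(u,v)$ is the shortest-path distance in $G$. For a total order $<$ on $V(G)$ and vertices $s<t$, $\varphi^{<}_{\max}(s,t)$ (resp. $\varphi^{<}_{\min}(s,t)$) is the maximum (resp. minimum) of the gains of all shortest oriented paths from $s$ to $t$, with respect to the lexicographic order on $\mathbb{C}$ ($a+ib\le c+id$ iff $a<c$, or $a=c$ and $b\le d$); further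 $\varphi^{<}_{\max}(t,s)=\overline{\varphi^{<}_{\max}(s,t)}$, $\varphi^{<}_{\min}(t,s)=\overline{\varphi^{<}_{\min}(s,t)}$, and both vanish on pairs $(s,s)$. $\mathcal{D}^{\max}_{<}(\Phi)=(\varphi^{<}_{\max}(v_i,v_j)d(v_i,v_j))_{i,j}$, $\mathcal{D}^{\min}_{<}(\Phi)=(\varphi^{<}_{\min}(v_i,v_j)d(v_i,v_j))_{i,j}$. Let $<$ be the standard order $v_1<\dots<v_n$ and $<_r$ its reverse. $\Phi$ is ordering independent if $\mathcal{D}^{\max}_{<}(\Phi)=\mathcal{D}^{\max}_{<_r}(\Phi)$ and $\mathcal{D}^{\min}_{<}(\Phi)=\mathcal{D}^{\min}_{<_r}(\Phi)$, and then $\mathcal{D}^{\max}(\Phi),\mathcal{D}^{\min}(\Phi)$ denote these common matrices. $\Phi$ is distance compatible if $\mathcal{D}^{\max}_{<}(\Phi)=\mathcal{D}^{\min}_{<}(\Phi)$ (this implies ordering independence), and then $\mathcal{D}(\Phi)$ denotes this common matrix. With $\mathrm{Tr}(G)=\mathrm{diag}(\mathrm{Tr}(v_1),\dots,\mathrm{Tr}(v_n))$, $\mathrm{Tr}(v_i)=\sum_j d(v_i,v_j)$: $\mathcal{DL}^{\max}(\Phi)=\mathrm{Tr}(G)-\mathcal{D}^{\max}(\Phi)$, $\mathcal{DL}^{\min}(\Phi)=\mathrm{Tr}(G)-\mathcal{D}^{\min}(\Phi)$, $\mathcal{DL}(\Phi)=\mathrm{Tr}(G)-\mathcal{D}(\Phi)$.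 Nullity is the dimension of the null space. *)

theory Defs
  imports
    "HOL-Analysis.Analysis"
    "Graph_Theory.Pair_Digraph"
    "Graph_Theory.Digraph_Component"
begin

text \<open>
  A simple graph is a \<^locale>\<open>pair_graph\<close>: a finite, loop-free, symmetric set of arcs, so that
  every edge is present in both orientations. Vertices are the elements of a type of sort
  \<open>{finite, linorder}\<close>, whose order is the standard order of the vertices and which also indexes
  the rows and columns of the matrices.
\<close>

type_synonym 'v cmatrix = "((complex, 'v) vec, 'v) vec"

definition gain_function :: "'v pair_pre_digraph \<Rightarrow> ('v \<times> 'v \<Rightarrow> complex) \<Rightarrow> bool" where
  "gain_function G \<phi> \<longleftrightarrow>
     (\<forall>(u, v) \<in> parcs G. cmod (\<phi> (u, v)) = 1 \<and> \<phi> (v, u) = cnj (\<phi> (u, v)))"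

definition gain :: "('v \<times> 'v \<Rightarrow> complex) \<Rightarrow> ('v \<times> 'v) list \<Rightarrow> complex" where
  "gain \<phi> p = prod_list (map \<phi> p)"

text \<open>
  In a symmetric digraph \<^const>\<open>pre_digraph.cycle\<close> also accepts the closed walk \<open>u, v, u\<close> along
  a single edge, which is not a cycle of the underlying simple graph; hence the length bound.
\<close>

definition balanced :: "'v pair_pre_digraph \<Rightarrow> ('v \<times> 'v \<Rightarrow> complex) \<Rightarrow> bool" where
  "balanced G \<phi> \<longleftrightarrow>
     (\<forall>p. pre_digraph.cycle (with_proj G) p \<and> 3 \<le> length p \<longrightarrow> gain \<phi> p = 1)"

definition gdist :: "'v pair_pre_digraph \<Rightarrow> 'v \<Rightarrow> 'v \<Rightarrow> nat" where
  "gdist G u v = (LEAST k. \<exists>p. pre_digraph.apath (with_proj G) u p v \<and> length p = k)"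

definition shortest_paths :: "'v pair_pre_digraph \<Rightarrow> 'v \<Rightarrow> 'v \<Rightarrow> ('v \<times> 'v) list set" where
  "shortest_paths G u v =
     {p. pre_digraph.apath (with_proj G) u p v \<and> length p = gdist G u v}"

definition lex_le :: "complex \<Rightarrow> complex \<Rightarrow> bool" where
  "lex_le z w \<longleftrightarrow> Re z < Re w \<or> Re z = Re w \<and> Im z \<le> Im w"

definition lex_Max :: "complex set \<Rightarrow> complex" where
  "lex_Max A = (THE z. z \<in> A \<and> (\<forall>w\<in>A. lex_le w z))"

definition lex_Min :: "complex set \<Rightarrow> complex" where
  "lex_Min A = (THE z. z \<in> A \<and> (\<forall>w\<in>A. lex_le z w))"

text \<open>The argument \<open>lt\<close> below is a strict total order on the vertices.\<close>

definition gain_max ::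
    "('v \<Rightarrow> 'v \<Rightarrow> bool) \<Rightarrow> 'v pair_pre_digraph \<Rightarrow> ('v \<times> 'v \<Rightarrow> complex) \<Rightarrow> 'v \<Rightarrow> 'v \<Rightarrow> complex" where
  "gain_max lt G \<phi> s t =
     (if lt s t then lex_Max (gain \<phi> ` shortest_paths G s t)
      else if lt t s then cnj (lex_Max (gain \<phi> ` shortest_paths G t s))
      else 0)"

definition gain_min ::
    "('v \<Rightarrow> 'v \<Rightarrow> bool) \<Rightarrow> 'v pair_pre_digraph \<Rightarrow> ('v \<times> 'v \<Rightarrow> complex) \<Rightarrow> 'v \<Rightarrow> 'v \<Rightarrow> complex" where
  "gain_min lt G \<phi> s t =
     (if lt s t then lex_Min (gain \<phi> ` shortest_paths G s t)
      else if lt t s then cnj (lex_Min (gain \<phi> ` shortest_paths G t s))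
      else 0)"

definition Dmax_ord ::
    "('v \<Rightarrow> 'v \<Rightarrow> bool) \<Rightarrow> 'v::finite pair_pre_digraph \<Rightarrow> ('v \<times> 'v \<Rightarrow> complex) \<Rightarrow> 'v cmatrix" where
  "Dmax_ord lt G \<phi> = (\<chi> i j. gain_max lt G \<phi> i j * of_nat (gdist G i j))"

definition Dmin_ord ::
    "('v \<Rightarrow> 'v \<Rightarrow> bool) \<Rightarrow> 'v::finite pair_pre_digraph \<Rightarrow> ('v \<times> 'v \<Rightarrow> complex) \<Rightarrow> 'v cmatrix" where
  "Dmin_ord lt G \<phi> = (\<chi> i j. gain_min lt G \<phi> i j * of_nat (gdist G i j))"

definition ordering_independent ::
    "'v::{finite,linorder} pair_pre_digraph \<Rightarrow> ('v \<times> 'v \<Rightarrow> complex) \<Rightarrow> bool" where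
  "ordering_independent G \<phi> \<longleftrightarrow>
     Dmax_ord (<) G \<phi> = Dmax_ord (>) G \<phi> \<and> Dmin_ord (<) G \<phi> = Dmin_ord (>) G \<phi>"

definition distance_compatible ::
    "'v::{finite,linorder} pair_pre_digraph \<Rightarrow> ('v \<times> 'v \<Rightarrow> complex) \<Rightarrow> bool" where
  "distance_compatible G \<phi> \<longleftrightarrow> Dmax_ord (<) G \<phi> = Dmin_ord (<) G \<phi>"

text \<open>
  \<open>Dmax\<close> and \<open>Dmin\<close> are meant for ordering independent gain graphs and \<open>Dcommon\<close> for distance
  compatible ones; they pick one of the two matrices that then coincide.
\<close>

definition Dmax :: "'v::{finite,linorder} pair_pre_digraph \<Rightarrow> ('v \<times> 'v \<Rightarrow> complex) \<Rightarrow> 'v cmatrix" where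
  "Dmax G \<phi> = Dmax_ord (<) G \<phi>"

definition Dmin :: "'v::{finite,linorder} pair_pre_digraph \<Rightarrow> ('v \<times> 'v \<Rightarrow> complex) \<Rightarrow> 'v cmatrix" where
  "Dmin G \<phi> = Dmin_ord (<) G \<phi>"

definition Dcommon :: "'v::{finite,linorder} pair_pre_digraph \<Rightarrow> ('v \<times> 'v \<Rightarrow> complex) \<Rightarrow> 'v cmatrix" where
  "Dcommon G \<phi> = Dmax_ord (<) G \<phi>"

definition transmission :: "'v::finite pair_pre_digraph \<Rightarrow> 'v \<Rightarrow> nat" where
  "transmission G v = (\<Sum>u\<in>UNIV. gdist G v u)"

definition Tr :: "'v::finite pair_pre_digraph \<Rightarrow> 'v cmatrix" where
  "Tr G = (\<chi> i j. if i = j then of_nat (transmission G i) else 0)"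

definition DLmax :: "'v::{finite,linorder} pair_pre_digraph \<Rightarrow> ('v \<times> 'v \<Rightarrow> complex) \<Rightarrow> 'v cmatrix" where
  "DLmax G \<phi> = Tr G - Dmax G \<phi>"

definition DLmin :: "'v::{finite,linorder} pair_pre_digraph \<Rightarrow> ('v \<times> 'v \<Rightarrow> complex) \<Rightarrow> 'v cmatrix" where
  "DLmin G \<phi> = Tr G - Dmin G \<phi>"

definition DL :: "'v::{finite,linorder} pair_pre_digraph \<Rightarrow> ('v \<times> 'v \<Rightarrow> complex) \<Rightarrow> 'v cmatrix" where
  "DL G \<phi> = Tr G - Dcommon G \<phi>"

text \<open>The dimension is over \<open>complex\<close>: \<^const>\<open>vec.dim\<close> refers to the scalar multiplication \<open>(*s)\<close>.\<close>

definition nullity :: "complex^'n^'m \<Rightarrow> nat" where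
  "nullity A = vec.dim {x. A *v x = 0}"

end

theory Submission
  imports Defs
begin

text \<open>
  Let \<open>g s t\<close> be the gain of some shortest path between \<open>s\<close> and \<open>t\<close>. A maximum modulus argument
  shows that \<open>x\<close> lies in the kernel of the Laplacian built from \<open>g\<close> and the distances iff
  \<open>x $ s = g s t * x $ t\<close> for all \<open>s \<noteq> t\<close>. Hence the kernel is at most one-dimensional, and a
  nonzero kernel vector is nowhere zero. As \<open>g\<close> agrees with the gain function on arcs, such a vector
  is a potential for the gains, which therefore telescope to 1 around cycles. Conversely, in a
  balanced graph all closed walks have gain 1, because they can be cut into cycles and edges
  traversed back and forth; so a potential \<open>f\<close> exists, every path from \<open>s\<close> to \<open>t\<close> has gain
  \<open>f s / f t\<close>, the choice of shortest paths is immaterial, and \<open>f\<close> lies in the kernel.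
\<close>

section \<open>Laplacians with unimodular phases\<close>

text \<open>Phases and weights are kept apart so that one kernel argument covers the Laplacians of
  both the maximal and the minimal gains.\<close>

definition phase_laplacian :: "('n \<Rightarrow> 'n \<Rightarrow> complex) \<Rightarrow> ('n \<Rightarrow> 'n \<Rightarrow> real) \<Rightarrow> complex^'n^'n::finite" where
  "phase_laplacian g d =
     (\<chi> i j. (if i = j then of_real (\<Sum>k\<in>UNIV. d i k) else 0) - g i j * of_real (d i j))"

text \<open>Spreading the row sum on the diagonal over the row turns each entry into a weighted sum
  of differences, the form that an averaging argument needs.\<close>

lemma phase_laplacian_mult_nth:
  "(phase_laplacian g d *v x) $ i = (\<Sum>j\<in>UNIV. of_real (d i j) * (x $ i - g i j * x $ j))"
proof -
  have "(phase_laplacian g d *v x) $ i =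
      (\<Sum>j\<in>UNIV. (if i = j then of_real (\<Sum>k\<in>UNIV. d i k) * x $ j else 0)
        - g i j * of_real (d i j) * x $ j)"
    unfolding phase_laplacian_def matrix_vector_mult_def
    by (simp add: left_diff_distrib) (intro sum.cong, auto simp: left_diff_distrib)
  also have "\<dots> = (\<Sum>k\<in>UNIV. of_real (d i k)) * x $ i - (\<Sum>j\<in>UNIV. g i j * of_real (d i j) * x $ j)"
    by (simp add: sum_subtractf)
  also have "\<dots> = (\<Sum>j\<in>UNIV. of_real (d i j) * (x $ i - g i j * x $ j))"
    by (simp only: sum_distrib_left sum_distrib_right right_diff_distrib sum_subtractf mult_ac)
  finally show ?thesis .
qed

text \<open>Expanding the squared modulus of \<open>z - w\<close> gives the equality case of
  Cauchy-Schwarz.\<close>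

lemma complex_eqI_inner:
  assumes "cmod w \<le> cmod z" and "(cmod z)\<^sup>2 \<le> z \<bullet> w"
  shows "z = w"
proof -
  have "(cmod (z - w))\<^sup>2 = (cmod z)\<^sup>2 + (cmod w)\<^sup>2 - 2 * (z \<bullet> w)"
    by (simp add: power2_norm_eq_inner inner_diff inner_commute)
  also have "\<dots> \<le> 0"
    using assms(2) power_mono[OF assms(1) norm_ge_zero, of 2] by linarith
  finally show ?thesis by simp
qed

locale phases =
  fixes g :: "'n::finite \<Rightarrow> 'n \<Rightarrow> complex" and d :: "'n \<Rightarrow> 'n \<Rightarrow> real"
  assumes unimodular: "i \<noteq> j \<Longrightarrow> cmod (g i j) = 1"
    and weight_diag: "d i i = 0"
    and weight_pos: "i \<noteq> j \<Longrightarrow> 0 < d i j"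
begin

text \<open>
  At an index where \<open>x\<close> has maximal modulus, \<open>x $ i\<close> is a weighted average of the numbers
  \<open>g i j * x $ j\<close>, none of which is larger in modulus; hence all of them equal \<open>x $ i\<close>, and
  every other index has maximal modulus as well.
\<close>

lemma kernel_iff:
  "phase_laplacian g d *v x = 0 \<longleftrightarrow> (\<forall>i j. i \<noteq> j \<longrightarrow> x $ i = g i j * x $ j)"
proof
  assume ker: "phase_laplacian g d *v x = 0"
  have step: "x $ i = g i j * x $ j"
    if max: "\<And>k. cmod (x $ k) \<le> cmod (x $ i)" and "i \<noteq> j" for i j
  proof -
    have le: "cmod (g i k * x $ k) \<le> cmod (x $ i)" if "i \<noteq> k" for k
      using max[of k] unimodular[OF that] by (simp add: norm_mult)
    \<comment> \<open>The real inner product on the complex plane replaces equality of complex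
      numbers by the sign of a real number.\<close>
    have nonneg: "0 \<le> d i k * (x $ i \<bullet> (x $ i - g i k * x $ k))" for k
    proof (cases "i = k")
      case False
      have "x $ i \<bullet> (g i k * x $ k) \<le> cmod (x $ i) * cmod (g i k * x $ k)"
        by (rule norm_cauchy_schwarz)
      also have "\<dots> \<le> x $ i \<bullet> x $ i"
        using mult_left_mono[OF le[OF False], of "cmod (x $ i)"]
        by (simp add: power2_norm_eq_inner[symmetric] power2_eq_square)
      finally show ?thesis
        using weight_pos[OF False] by (simp add: inner_diff_right)
    qed (simp add: weight_diag)
    \<comment> \<open>Row \<open>i\<close> of the kernel equation, paired with \<open>x $ i\<close>:
      a sum of nonnegative terms is zero, so each term is.\<close>
    have "(\<Sum>k\<in>UNIV. d i k * (x $ i \<bullet> (x $ i - g i k * x $ k)))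
        = x $ i \<bullet> (\<Sum>k\<in>UNIV. d i k *\<^sub>R (x $ i - g i k * x $ k))"
      by (simp add: inner_sum_right)
    also have "\<dots> = x $ i \<bullet> (phase_laplacian g d *v x) $ i"
      unfolding phase_laplacian_mult_nth by (simp add: scaleR_conv_of_real)
    also have "\<dots> = 0"
      by (simp add: ker)
    finally have "d i j * (x $ i \<bullet> (x $ i - g i j * x $ j)) = 0"
      by (simp add: sum_nonneg_eq_0_iff nonneg)
    then have "(cmod (x $ i))\<^sup>2 \<le> x $ i \<bullet> (g i j * x $ j)"
      using weight_pos[OF \<open>i \<noteq> j\<close>] by (simp add: inner_diff_right power2_norm_eq_inner)
    with le[OF \<open>i \<noteq> j\<close>] show ?thesis
      by (rule complex_eqI_inner)
  qed
  obtain m where m: "\<And>k. cmod (x $ k) \<le> cmod (x $ m)"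
  proof -
    have "Max (range (\<lambda>k. cmod (x $ k))) \<in> range (\<lambda>k. cmod (x $ k))"
      by (rule Max_in) auto
    then obtain m where "Max (range (\<lambda>k. cmod (x $ k))) = cmod (x $ m)" by (rule imageE)
    then show thesis
      by (metis Max_ge finite finite_imageI rangeI that)
  qed
  have const: "cmod (x $ i) = cmod (x $ m)" for i
  proof (cases "i = m")
    case False
    then show ?thesis using step[OF m, of i] unimodular[of m i] by (simp add: norm_mult)
  qed simp
  show "\<forall>i j. i \<noteq> j \<longrightarrow> x $ i = g i j * x $ j"
  proof (intro allI impI)
    fix i j :: 'n
    assume "i \<noteq> j"
    moreover have "cmod (x $ k) \<le> cmod (x $ i)" for k
      using m[of k] const[of i] by linarith
    ultimately show "x $ i = g i j * x $ j" by (intro step)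
  qed
next
  assume eq: "\<forall>i j. i \<noteq> j \<longrightarrow> x $ i = g i j * x $ j"
  have "of_real (d i j) * (x $ i - g i j * x $ j) = 0" for i j
    using eq weight_diag by (cases "i = j") auto
  then show "phase_laplacian g d *v x = 0"
    unfolding vec_eq_iff phase_laplacian_mult_nth by (auto intro: sum.neutral)
qed

text \<open>By \<open>kernel_iff\<close>, a single zero entry would force all the others to
  vanish.\<close>

lemma kernel_nth_nonzero:
  assumes ker: "phase_laplacian g d *v x = 0" and "x \<noteq> 0"
  shows "x $ i \<noteq> 0"
proof
  assume "x $ i = 0"
  then have "x $ j = 0" for j
    using ker unfolding kernel_iff by (cases "j = i") auto
  with \<open>x \<noteq> 0\<close> show False by (simp add: vec_eq_iff)
qed

text \<open>A kernel vector is determined by any one of its entries, so a nonzero one spans the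
  kernel.\<close>

lemma nullity_le_1: "nullity (phase_laplacian g d) \<le> 1"
proof (cases "\<exists>x. phase_laplacian g d *v x = 0 \<and> x \<noteq> 0")
  case True
  then obtain x where x: "phase_laplacian g d *v x = 0" "x \<noteq> 0" by blast
  fix m :: 'n
  have "y \<in> vec.span {x}" if y: "phase_laplacian g d *v y = 0" for y
  proof -
    \<comment> \<open>The ratio at an arbitrary index; the denominator is nonzero because
      \<open>x\<close> vanishes nowhere.\<close>
    define c where "c = y $ m / x $ m"
    have "y $ i = c * x $ i" for i
    proof (cases "i = m")
      case False
      then have "y $ i = g i m * y $ m" "x $ i = g i m * x $ m"
        using x(1) y unfolding kernel_iff by blast+
      then show ?thesis using kernel_nth_nonzero[OF x, of m] by (simp add: c_def)
    qed (simp add: c_def kernel_nth_nonzero[OF x])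
    then have "y = c *s x" by (simp add: vec_eq_iff)
    then show ?thesis by (simp add: vec.span_scale vec.span_base)
  qed
  then have "vec.dim {y. phase_laplacian g d *v y = 0} \<le> card {x}"
    by (intro vec.dim_le_card) auto
  then show ?thesis by (simp add: nullity_def)
next
  case False
  then have "{y. phase_laplacian g d *v y = 0} \<subseteq> {0}" by blast
  then have "vec.dim {y. phase_laplacian g d *v y = 0} = 0"
    using vec.dim_eq_0 by blast
  then show ?thesis unfolding nullity_def by linarith
qed

end

section \<open>Determinant and nullity\<close>

lemma det_eq_0_iff_kernel:
  fixes A :: "'a::field^'n^'n"
  shows "det A = 0 \<longleftrightarrow> (\<exists>x. A *v x = 0 \<and> x \<noteq> 0)"
  using invertible_det_nz[of A] invertible_left_inverse[of A] matrix_left_invertible_ker[of A]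
  by blast

lemma nullity_eq_0_iff:
  fixes A :: "complex^'n^'n"
  shows "nullity A = 0 \<longleftrightarrow> det A \<noteq> 0"
  unfolding nullity_def vec.dim_eq_0 det_eq_0_iff_kernel by blast

lemma (in phases) nullity_eq_1_iff:
  "nullity (phase_laplacian g d) = 1 \<longleftrightarrow> det (phase_laplacian g d) = 0"
  using nullity_le_1 nullity_eq_0_iff[of "phase_laplacian g d"] by linarith

section \<open>Lexicographic extrema\<close>

lemma lex_le_antisym: "lex_le z w \<Longrightarrow> lex_le w z \<Longrightarrow> z = w"
  by (auto simp: lex_le_def complex_eq_iff)

lemma lex_le_trans: "lex_le z w \<Longrightarrow> lex_le w v \<Longrightarrow> lex_le z v"
  by (auto simp: lex_le_def)

lemma lex_le_linear: "lex_le z w \<or> lex_le w z"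
  by (auto simp: lex_le_def)

text \<open>Existence by induction on the finite set and uniqueness by antisymmetry make the
  definite description meaningful.\<close>

lemma lex_Max_in:
  assumes "finite A" and "A \<noteq> {}"
  shows "lex_Max A \<in> A"
proof -
  have "\<exists>z\<in>A. \<forall>w\<in>A. lex_le w z"
    using assms
  proof (induction rule: finite_ne_induct)
    case (singleton z)
    then show ?case using lex_le_linear by auto
  next
    case (insert a A)
    then show ?case using lex_le_linear lex_le_trans by (metis insert_iff)
  qed
  then have "\<exists>!z. z \<in> A \<and> (\<forall>w\<in>A. lex_le w z)"
    using lex_le_antisym by blast
  from theI'[OF this] show ?thesis by (simp add: lex_Max_def)
qed

lemma lex_Min_in:
  assumes "finite A" and "A \<noteq> {}"
  shows "lex_Min A \<in> A"
proof -
  have "\<exists>z\<in>A. \<forall>w\<in>A. lex_le z w"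
    using assms
  proof (induction rule: finite_ne_induct)
    case (singleton z)
    then show ?case using lex_le_linear by auto
  next
    case (insert a A)
    then show ?case using lex_le_linear lex_le_trans by (metis insert_iff)
  qed
  then have "\<exists>!z. z \<in> A \<and> (\<forall>w\<in>A. lex_le z w)"
    using lex_le_antisym by blast
  from theI'[OF this] show ?thesis by (simp add: lex_Min_def)
qed

section \<open>Balanced gain graphs\<close>

lemma gain_simps [simp]:
  "gain \<phi> [] = 1" "gain \<phi> (e # p) = \<phi> e * gain \<phi> p" "gain \<phi> (p @ q) = gain \<phi> p * gain \<phi> q"
  by (simp_all add: gain_def)

locale gain_graph = pair_graph G
  for G :: "'v::finite pair_pre_digraph" +
  fixes \<phi> :: "'v \<times> 'v \<Rightarrow> complex"
  assumes all_verts: "pverts G = UNIV"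
    and conn: "Digraph_Component.connected (with_proj G)"
    and gain_fun: "gain_function G \<phi>"
begin

lemma gain_arc:
  assumes "(u, v) \<in> parcs G"
  shows "cmod (\<phi> (u, v)) = 1" and "\<phi> (v, u) = cnj (\<phi> (u, v))"
  using gain_fun assms by (auto simp: gain_function_def)

lemma gain_arc_inverse:
  assumes "(u, v) \<in> parcs G"
  shows "\<phi> (u, v) * \<phi> (v, u) = 1"
  using gain_arc[OF assms] by (simp add: complex_norm_square[symmetric])

lemma awalk_ConsE:
  assumes "awalk u (e # p) v"
  obtains w where "e = (u, w)" "(u, w) \<in> parcs G" "awalk w p v"
  using assms by (cases e) (auto simp: awalk_Cons_iff)

lemma norm_gain_awalk:
  assumes "awalk u p v"
  shows "cmod (gain \<phi> p) = 1"
  using assms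
proof (induction p arbitrary: u)
  case (Cons e p)
  from Cons.prems obtain w where "e = (u, w)" "(u, w) \<in> parcs G" "awalk w p v"
    by (rule awalk_ConsE)
  then show ?case using Cons.IH gain_arc(1) by (simp add: norm_mult)
qed simp

lemma gain_awalk_telescope:
  assumes "\<And>u v. (u, v) \<in> parcs G \<Longrightarrow> f u = \<phi> (u, v) * f v" and "awalk u p v"
  shows "f u = gain \<phi> p * f v"
  using assms(2)
proof (induction p arbitrary: u)
  case Nil
  then show ?case by (simp add: awalk_Nil_iff)
next
  case (Cons e p)
  from Cons.prems obtain w where "e = (u, w)" "(u, w) \<in> parcs G" "awalk w p v"
    by (rule awalk_ConsE)
  then show ?case using Cons.IH[of w] assms(1)[of u w] by simp
qed

lemma ex_apath: "\<exists>p. apath u p v"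
proof -
  \<comment> \<open>Connectedness is defined through the symmetric closure, which is
    \<open>G\<close> itself here.\<close>
  have "mk_symmetric (with_proj G) = G"
    by (rule pair_pre_digraph.equality) (auto simp: mk_symmetric_def intro: arcs_symmetric)
  then have "u \<rightarrow>\<^sup>*\<^bsub>with_proj G\<^esub> v"
    using conn all_verts by (simp add: connected_def strongly_connected_def)
  then show ?thesis by (simp add: reachable_apath)
qed

text \<open>Strong induction on the length: a walk with a repeated inner vertex is cut there into
  two shorter closed walks.\<close>

lemma gain_closed_walk:
  assumes bal: "balanced G \<phi>" and "awalk u p u"
  shows "gain \<phi> p = 1"
  using assms(2)
proof (induction p arbitrary: u rule: length_induct)
  case (1 p)
  note IH = "1.IH"[rule_format] and walk = "1.prems"
  show ?case
  proof (cases p)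
    case (Cons e q)
    with walk obtain w where e: "e = (u, w)" "(u, w) \<in> parcs G" and q: "awalk w q u"
      by (auto elim: awalk_ConsE)
    show ?thesis
    \<comment> \<open>\<open>tl\<close> drops the start vertex, which a closed walk visits again at
      its end.\<close>
    proof (cases "distinct (tl (awalk_verts u p))")
      case True
      then have cyc: "cycle p"
        using walk Cons by (auto simp: cycle_def)
      show ?thesis
      proof (cases "3 \<le> length p")
        case True
        with cyc bal show ?thesis by (simp add: balanced_def)
      next
        case False
        \<comment> \<open>Balance says nothing about length two; such a walk goes along an edge and
          back, and the two gains cancel.\<close>
        from cyc have "2 \<le> length p" by (auto simp: cycle_digraph_conv)
        with False Cons obtain e' where "q = [e']"
          by (cases q; cases "tl q") auto
        with q have "e' = (w, u)"
          by (cases e') (auto simp: awalk_Cons_iff awalk_Nil_iff)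
        then show ?thesis
          using Cons e \<open>q = [e']\<close> gain_arc_inverse by simp
      qed
    next
      case False
      then have "\<not> distinct (awalk_verts w q)"
        using Cons e by simp
      then obtain a b c x where split: "q = a @ b @ c" "awalk w a x" "awalk x b x" "awalk x c u"
          and "closed_w b"
        using q by (elim awalk_cyc_decompE') auto
      have "b \<noteq> []" using \<open>closed_w b\<close> by (auto simp: closed_w_def)
      \<comment> \<open>The closed part \<open>b\<close> is shorter than \<open>p\<close> because it
        lacks \<open>e\<close>; the remainder is shorter because \<open>b\<close> is
        nonempty.\<close>
      have "gain \<phi> b = 1"
        using IH[of b x] split Cons by simp
      moreover have "awalk u (e # a @ c) u"
        using e split by (auto simp: awalk_Cons_iff)
      then have "gain \<phi> (e # a @ c) = 1"
        using IH[of "e # a @ c" u] \<open>b \<noteq> []\<close> split Cons by simp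
      ultimately show ?thesis
        using Cons split by simp
    qed
  qed simp
qed

text \<open>The potential at \<open>v\<close> is the gain of a walk from \<open>v\<close> to a fixed root.\<close>

lemma balanced_imp_potential:
  assumes "balanced G \<phi>"
  obtains f where "\<And>v. cmod (f v) = 1"
    and "\<And>u v. (u, v) \<in> parcs G \<Longrightarrow> f u = \<phi> (u, v) * f v"
proof -
  fix r :: 'v
  obtain P Q where P: "\<And>v. awalk v (P v) r" and Q: "\<And>v. awalk r (Q v) v"
  proof -
    obtain R where "\<And>u v. awalk u (R u v) v"
      using ex_apath awalkI_apath by metis
    then show thesis using that[of "\<lambda>v. R v r" "R r"] by blast
  qed
  have PQ: "gain \<phi> (Q v) * gain \<phi> (P v) = 1" for v
    using gain_closed_walk[OF assms awalk_appendI[OF Q P], of v] by simp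
  have "gain \<phi> (P u) = \<phi> (u, v) * gain \<phi> (P v)" if "(u, v) \<in> parcs G" for u v
  proof -
    have "awalk u ((u, v) # P v) r"
      using P that by (auto simp: awalk_Cons_iff)
    then have "awalk r (Q u @ (u, v) # P v) r"
      using Q by (rule awalk_appendI[rotated])
    from gain_closed_walk[OF assms this]
    have "gain \<phi> (Q u) * (\<phi> (u, v) * gain \<phi> (P v)) = 1" by simp
    \<comment> \<open>Two closed walks at the root start with \<open>Q u\<close>; its nonzero gain
      cancels.\<close>
    then have "gain \<phi> (Q u) * gain \<phi> (P u) = gain \<phi> (Q u) * (\<phi> (u, v) * gain \<phi> (P v))"
      and "gain \<phi> (Q u) \<noteq> 0"
      using PQ[of u] by auto
    then show ?thesis by simp
  qed
  then show thesis
    using that[of "\<lambda>v. gain \<phi> (P v)"] norm_gain_awalk P by blast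
qed

lemma balancedI_potential:
  assumes "\<And>v. f v \<noteq> 0" and "\<And>u v. (u, v) \<in> parcs G \<Longrightarrow> f u = \<phi> (u, v) * f v"
  shows "balanced G \<phi>"
  unfolding balanced_def
proof (intro allI impI)
  fix p assume "cycle p \<and> 3 \<le> length p"
  then obtain u where "awalk u p u" by (auto simp: cycle_def)
  then have "f u = gain \<phi> p * f u" using gain_awalk_telescope[of f u p u] assms(2) by blast
  with assms(1)[of u] show "gain \<phi> p = 1" by simp
qed

section \<open>Shortest paths\<close>

lemma shortest_paths_nonempty: "shortest_paths G u v \<noteq> {}"
proof -
  have "\<exists>k p. apath u p v \<and> length p = k" using ex_apath by blast
  then have "\<exists>p. apath u p v \<and> length p = gdist G u v"
    unfolding gdist_def by (rule LeastI_ex)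
  then show ?thesis by (simp add: shortest_paths_def)
qed

lemma gdist_le: "apath u p v \<Longrightarrow> gdist G u v \<le> length p"
  unfolding gdist_def by (rule Least_le) blast

lemma gdist_self: "gdist G u u = 0"
  using gdist_le[of u "[]" u] all_verts by (simp add: apath_Nil_iff)

lemma gdist_pos:
  assumes "u \<noteq> v"
  shows "0 < gdist G u v"
proof (rule gr0I)
  assume "gdist G u v = 0"
  then have "apath u [] v"
    using shortest_paths_nonempty[of u v] by (auto simp: shortest_paths_def)
  with assms show False by (simp add: apath_Nil_iff)
qed

lemma finite_shortest_paths: "finite (shortest_paths G u v)"
proof (rule finite_subset)
  show "shortest_paths G u v \<subseteq> {p. set p \<subseteq> UNIV \<and> length p = gdist G u v}"
    by (auto simp: shortest_paths_def)
qed (rule finite_lists_length_eq[OF finite])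

text \<open>The arc is the only walk of length one between its ends, so no choice of extremum can
  change its gain.\<close>

lemma shortest_paths_arc:
  assumes "(u, v) \<in> parcs G"
  shows "shortest_paths G u v = {[(u, v)]}"
proof -
  have "u \<noteq> v" using assms no_loops' by blast
  then have path: "apath u [(u, v)] v"
    using assms all_verts by (auto simp: apath_def awalk_Cons_iff awalk_Nil_iff)
  then have dist: "gdist G u v = 1"
    using gdist_le[OF path] gdist_pos[OF \<open>u \<noteq> v\<close>] by simp
  have "p = [(u, v)]" if "awalk u p v" "length p = 1" for p
    using that by (cases p) (auto simp: awalk_Cons_iff awalk_Nil_iff)
  then show ?thesis
    using path unfolding shortest_paths_def dist by (auto dest: awalkI_apath)
qed

lemma lex_Max_gain_in: "lex_Max (gain \<phi> ` shortest_paths G u v) \<in> gain \<phi> ` shortest_paths G u v"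
  by (simp add: lex_Max_in finite_shortest_paths shortest_paths_nonempty)

lemma lex_Min_gain_in: "lex_Min (gain \<phi> ` shortest_paths G u v) \<in> gain \<phi> ` shortest_paths G u v"
  by (simp add: lex_Min_in finite_shortest_paths shortest_paths_nonempty)

text \<open>Abstracts from max or min and from the vertex order: the second alternative covers pairs
  whose value is conjugated from the reverse direction. The diagonal is left free.\<close>

definition shortest_gain :: "('v \<Rightarrow> 'v \<Rightarrow> complex) \<Rightarrow> bool" where
  "shortest_gain g \<longleftrightarrow> (\<forall>s t. s \<noteq> t \<longrightarrow>
     (\<exists>p\<in>shortest_paths G s t. g s t = gain \<phi> p) \<or>
     (\<exists>p\<in>shortest_paths G t s. g s t = cnj (gain \<phi> p)))"

lemma shortest_gain_gain_max:
  assumes "\<And>s t. s \<noteq> t \<Longrightarrow> lt s t \<or> lt t s"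
  shows "shortest_gain (gain_max lt G \<phi>)"
  unfolding shortest_gain_def
proof (intro allI impI)
  fix s t :: 'v
  assume "s \<noteq> t"
  with assms have "lt s t \<or> lt t s" by simp
  then show "(\<exists>p\<in>shortest_paths G s t. gain_max lt G \<phi> s t = gain \<phi> p) \<or>
      (\<exists>p\<in>shortest_paths G t s. gain_max lt G \<phi> s t = cnj (gain \<phi> p))"
    using lex_Max_gain_in[of s t] lex_Max_gain_in[of t s] unfolding gain_max_def image_iff by auto
qed

lemma shortest_gain_gain_min:
  assumes "\<And>s t. s \<noteq> t \<Longrightarrow> lt s t \<or> lt t s"
  shows "shortest_gain (gain_min lt G \<phi>)"
  unfolding shortest_gain_def
proof (intro allI impI)
  fix s t :: 'v
  assume "s \<noteq> t"
  with assms have "lt s t \<or> lt t s" by simp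
  then show "(\<exists>p\<in>shortest_paths G s t. gain_min lt G \<phi> s t = gain \<phi> p) \<or>
      (\<exists>p\<in>shortest_paths G t s. gain_min lt G \<phi> s t = cnj (gain \<phi> p))"
    using lex_Min_gain_in[of s t] lex_Min_gain_in[of t s] unfolding gain_min_def image_iff by auto
qed

lemma shortest_gain_arc:
  assumes "shortest_gain g" and "(u, v) \<in> parcs G"
  shows "g u v = \<phi> (u, v)"
proof -
  have "(v, u) \<in> parcs G" "u \<noteq> v"
    using assms(2) no_loops' arcs_symmetric by blast+
  then show ?thesis
    using assms gain_arc(2)[OF assms(2)]
    by (fastforce simp: shortest_gain_def shortest_paths_arc)
qed

lemma phases_shortest_gain:
  assumes "shortest_gain g"
  shows "phases g (\<lambda>u v. real (gdist G u v))"
proof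
  show "cmod (g u v) = 1" if "u \<noteq> v" for u v
  proof -
    have "cmod (gain \<phi> p) = 1" if "p \<in> shortest_paths G a b" for a b p
      using that norm_gain_awalk by (auto simp: shortest_paths_def dest: awalkI_apath)
    with assms that show ?thesis
      unfolding shortest_gain_def by (metis complex_mod_cnj)
  qed
qed (simp_all add: gdist_self gdist_pos)

lemma shortest_gain_potential:
  assumes "shortest_gain g" and "u \<noteq> v" and unit: "\<And>v. cmod (f v) = 1"
    and pot: "\<And>u v. (u, v) \<in> parcs G \<Longrightarrow> f u = \<phi> (u, v) * f v"
  shows "g u v = f u / f v"
proof -
  have nz: "f w \<noteq> 0" for w using unit[of w] by auto
  \<comment> \<open>Conjugation inverts \<open>f\<close>, so a path from \<open>v\<close> to
    \<open>u\<close> yields the same quotient as one from \<open>u\<close> to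
    \<open>v\<close>.\<close>
  have cnj_f: "cnj (f w) = 1 / f w" for w
    using unit[of w] complex_norm_square[of "f w"] nz[of w] by (simp add: field_simps)
  have *: "gain \<phi> p = f a / f b" if "p \<in> shortest_paths G a b" for a b p
    using that gain_awalk_telescope[of f a p b] pot nz[of b]
    by (auto simp: shortest_paths_def dest: awalkI_apath)
  show ?thesis
    using assms(1,2) unfolding shortest_gain_def by (fastforce dest: * simp: cnj_f)
qed

text \<open>A nonzero kernel vector, read along arcs, is a potential; conversely a unimodular
  potential satisfies the kernel equations for all pairs.\<close>

lemma det_eq_0_iff_balanced:
  assumes g: "shortest_gain g"
  shows "det (phase_laplacian g (\<lambda>u v. real (gdist G u v))) = 0 \<longleftrightarrow> balanced G \<phi>" (is "det ?L = 0 \<longleftrightarrow> _")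
proof -
  interpret phases g "\<lambda>u v. real (gdist G u v)"
    using g by (rule phases_shortest_gain)
  show ?thesis
  proof
    assume "det ?L = 0"
    then obtain x where x: "?L *v x = 0" "x \<noteq> 0" by (auto simp: det_eq_0_iff_kernel)
    show "balanced G \<phi>"
    proof (rule balancedI_potential)
      show "x $ v \<noteq> 0" for v by (rule kernel_nth_nonzero[OF x])
      show "x $ u = \<phi> (u, v) * x $ v" if "(u, v) \<in> parcs G" for u v
        using x(1) that shortest_gain_arc[OF g that] no_loops' unfolding kernel_iff by metis
    qed
  next
    assume "balanced G \<phi>"
    then obtain f where f: "\<And>v. cmod (f v) = 1"
        "\<And>u v. (u, v) \<in> parcs G \<Longrightarrow> f u = \<phi> (u, v) * f v"
      by (rule balanced_imp_potential) blast
    have nz: "f w \<noteq> 0" for w using f(1)[of w] by auto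
    have "?L *v (\<chi> v. f v) = 0"
      unfolding kernel_iff using shortest_gain_potential[OF g _ f] nz by simp
    moreover have "(\<chi> v. f v) \<noteq> 0" using nz by (simp add: vec_eq_iff)
    ultimately show "det ?L = 0" by (auto simp: det_eq_0_iff_kernel)
  qed
qed

lemma nullity_eq_1_iff_balanced:
  assumes "shortest_gain g"
  shows "nullity (phase_laplacian g (\<lambda>u v. real (gdist G u v))) = 1 \<longleftrightarrow> balanced G \<phi>"
  using phases.nullity_eq_1_iff[OF phases_shortest_gain[OF assms]] det_eq_0_iff_balanced[OF assms]
  by simp

lemma balanced_shortest_gain_unique:
  assumes "balanced G \<phi>" and "shortest_gain g" and "shortest_gain h"
  shows "g u v * of_nat (gdist G u v) = h u v * of_nat (gdist G u v)"
\<comment> \<open>On the diagonal \<open>g\<close> and \<open>h\<close> may differ, but the distance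
  factor is zero.\<close>
proof (cases "u = v")
  case False
  obtain f where f: "\<And>v. cmod (f v) = 1"
      "\<And>u v. (u, v) \<in> parcs G \<Longrightarrow> f u = \<phi> (u, v) * f v"
    using assms(1) by (rule balanced_imp_potential) blast
  show ?thesis
    using shortest_gain_potential[OF assms(2) False f] shortest_gain_potential[OF assms(3) False f]
    by simp
qed (simp add: gdist_self)

end

theorem theorem3p9:
  fixes G :: "'v::{finite,linorder} pair_pre_digraph"
    and \<phi> :: "'v \<times> 'v \<Rightarrow> complex"
  assumes "pair_graph G"
    and "pverts G = UNIV"
    and "Digraph_Component.connected (with_proj G)"
    and "gain_function G \<phi>"
  shows "(balanced G \<phi> \<longleftrightarrow> ordering_independent G \<phi> \<and> nullity (DLmax G \<phi>) = 1)
       \<and> (balanced G \<phi> \<longleftrightarrow> ordering_independent G \<phi> \<and> nullity (DLmin G \<phi>) = 1)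
       \<and> (balanced G \<phi> \<longleftrightarrow> distance_compatible G \<phi> \<and> nullity (DL G \<phi>) = 1)
       \<and> (balanced G \<phi> \<longleftrightarrow> ordering_independent G \<phi> \<and> det (DLmax G \<phi>) = 0)
       \<and> (balanced G \<phi> \<longleftrightarrow> ordering_independent G \<phi> \<and> det (DLmin G \<phi>) = 0)
       \<and> (balanced G \<phi> \<longleftrightarrow> distance_compatible G \<phi> \<and> det (DL G \<phi>) = 0)"
proof -
  interpret gain_graph G \<phi>
    using assms by (simp add: gain_graph_def gain_graph_axioms_def)
  have max: "shortest_gain (gain_max (<) G \<phi>)" "shortest_gain (gain_max (>) G \<phi>)"
    and min: "shortest_gain (gain_min (<) G \<phi>)" "shortest_gain (gain_min (>) G \<phi>)"
    by (auto intro!: shortest_gain_gain_max shortest_gain_gain_min)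
  \<comment> \<open>\<open>DL\<close> and \<open>DLmax\<close> agree by definition, so only two
    Laplacians remain.\<close>
  have lap: "DLmax G \<phi> = phase_laplacian (gain_max (<) G \<phi>) (\<lambda>u v. real (gdist G u v))"
    "DL G \<phi> = DLmax G \<phi>"
    "DLmin G \<phi> = phase_laplacian (gain_min (<) G \<phi>) (\<lambda>u v. real (gdist G u v))"
    by (simp_all add: vec_eq_iff phase_laplacian_def DLmax_def DLmin_def DL_def Dmax_def Dmin_def
        Dcommon_def Dmax_ord_def Dmin_ord_def Tr_def transmission_def)
  \<comment> \<open>Balance makes all four matrices, for max and min under both orders,
    coincide.\<close>
  have "ordering_independent G \<phi>" "distance_compatible G \<phi>" if "balanced G \<phi>"
    using balanced_shortest_gain_unique[OF that] max min
    by (simp_all add: ordering_independent_def distance_compatible_def Dmax_ord_def Dmin_ord_def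
        vec_eq_iff)
  then show ?thesis
    unfolding lap using nullity_eq_1_iff_balanced det_eq_0_iff_balanced max min by blast
qed

end
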